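(* Let $\alpha,\beta<\epsilon_0$ and let $X=X_0\cup X_1\subseteq\mathbb{N}$ be a finite $(\alpha\oplus\beta)$-large set. Then either $X_0\setminus\{\max X_0\}$ is $\alpha$-large, or $X_1\setminus\{\max X_1\}$ is $\beta$-large, or $X_0$ is exactly $\alpha$-large and $X_1$ is exactly $\beta$-large.
   Context: $\oplus$ is the natural (Hessenberg) sum of ordinals. Fundamental sequences: $\{0\}(x)=0$; for $\alpha\neq0$ write $\alpha=\delta+\omega^\gamma$ in Cantor normal form with $\omega^\gamma$ the last term; $\{\alpha\}(x)=\delta$ if $\gamma=0$, $\delta+\omega^{\gamma'}\cdot x$ if $\gamma=\gamma'+1$, $\delta+\omega^{\{\gamma\}(x)}$ if $\gamma$ is a limit. For finite $X=\{x_0<\dots<x_s\}$, $\{\alpha\}(X)=\{\cdots\{\{\alpha\}(x_0)\}(x_1)\cdots\}(x_s)$ and $X$ is $\alpha$-large iff $\{\alpha\}(X)=0$, $\alpha$-small otherwise. $X$ is exactly $\alpha$-large if it is $\alpha$-large and $X\setminus\{\max X\}$ is $\alpha$-small.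
   Formalization: X is required to consist of positive integers; if 0 is allowed in X the claim fails, e.g. for α=ω², β=ω^ω, X_0={1,2,3,4}, X_1={0}, since {ω^ω}(0)=1. *)

theory Defs
  imports "HOL-Library.Multiset"
begin

text \<open>
  Ordinals below \<open>\<epsilon>\<^sub>0\<close> are represented by their Cantor normal forms: the term
  \<open>Ord [\<gamma>\<^sub>0, \<dots>, \<gamma>\<^sub>k]\<close> stands for \<open>\<omega>\<^bsup>\<gamma>\<^sub>0\<^esup> + \<dots> + \<omega>\<^bsup>\<gamma>\<^sub>k\<^esup>\<close>, and \<open>Ord []\<close> for \<open>0\<close>. The
  predicate \<open>cnf\<close> requires \<open>\<gamma>\<^sub>0 \<ge> \<dots> \<ge> \<gamma>\<^sub>k\<close> hereditarily, so every ordinal below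
  \<open>\<epsilon>\<^sub>0\<close> is denoted by exactly one term satisfying \<open>cnf\<close>. On such terms the ordering of
  ordinals is the lexicographic one.
\<close>

datatype ordinal = Ord (exps: "ordinal list")

instantiation ordinal :: zero
begin
definition "0 = Ord []"
instance ..
end

fun ord_lt :: "ordinal \<Rightarrow> ordinal \<Rightarrow> bool" where
  "ord_lt (Ord as) (Ord []) \<longleftrightarrow> False"
| "ord_lt (Ord []) (Ord (b # bs)) \<longleftrightarrow> True"
| "ord_lt (Ord (a # as)) (Ord (b # bs)) \<longleftrightarrow> ord_lt a b \<or> a = b \<and> ord_lt (Ord as) (Ord bs)"

lemma ord_lt_irrefl: "\<not> ord_lt a a"
proof (induction "size a" arbitrary: a rule: less_induct)
  case less
  show ?case
  proof (cases a)
    case (Ord as)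
    then show ?thesis using less by (cases as) auto
  qed
qed

lemma ord_lt_trans: "ord_lt a b \<Longrightarrow> ord_lt b c \<Longrightarrow> ord_lt a c"
proof (induction a b arbitrary: c rule: ord_lt.induct)
  case (3 a as b bs)
  obtain c' cs where c: "c = Ord (c' # cs)"
    using "3.prems"(2) by (metis ordinal.exhaust list.exhaust ord_lt.simps(1))
  show ?case using 3 unfolding c by auto
next
  case (2 b bs)
  then show ?case by (metis list.exhaust ordinal.exhaust ord_lt.simps(1) ord_lt.simps(2))
qed auto

lemma ord_lt_total: "ord_lt a b \<or> a = b \<or> ord_lt b a"
proof (induction a b rule: ord_lt.induct)
  case (1 as)
  then show ?case by (cases as) auto
qed auto

instantiation ordinal :: linorder
begin
definition "a < b \<longleftrightarrow> ord_lt a b" for a b :: ordinal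
definition "a \<le> b \<longleftrightarrow> ord_lt a b \<or> a = b" for a b :: ordinal
instance
proof
  fix x y z :: ordinal
  show "x < y \<longleftrightarrow> x \<le> y \<and> \<not> y \<le> x"
    unfolding less_ordinal_def less_eq_ordinal_def using ord_lt_irrefl ord_lt_trans by metis
  show "x \<le> x" unfolding less_eq_ordinal_def by simp
  show "x \<le> z" if "x \<le> y" "y \<le> z"
    using that ord_lt_trans unfolding less_eq_ordinal_def by metis
  show "x = y" if "x \<le> y" "y \<le> x"
    using that ord_lt_irrefl ord_lt_trans unfolding less_eq_ordinal_def by metis
  show "x \<le> y \<or> y \<le> x" using ord_lt_total unfolding less_eq_ordinal_def by metis
qed
end

fun cnf :: "ordinal \<Rightarrow> bool" where
  "cnf (Ord gs) \<longleftrightarrow> sorted_wrt (\<ge>) gs \<and> (\<forall>g \<in> set gs. cnf g)"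

text \<open>The natural sum collects the terms of both normal forms in non-increasing order.\<close>

definition natural_sum :: "ordinal \<Rightarrow> ordinal \<Rightarrow> ordinal" (infixl "\<oplus>" 65) where
  "\<alpha> \<oplus> \<beta> = Ord (rev (sort (exps \<alpha> @ exps \<beta>)))"

text \<open>
  A nonzero \<open>\<gamma>\<close> is a successor iff the last term of its normal form is \<open>\<omega>\<^sup>0\<close>; its
  predecessor is obtained by dropping that term.
\<close>

definition is_succ :: "ordinal \<Rightarrow> bool" where
  "is_succ \<gamma> \<longleftrightarrow> \<gamma> \<noteq> 0 \<and> last (exps \<gamma>) = 0"

definition ord_pred :: "ordinal \<Rightarrow> ordinal" where
  "ord_pred \<gamma> = Ord (butlast (exps \<gamma>))"

function fund :: "ordinal \<Rightarrow> nat \<Rightarrow> ordinal" where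
  "fund (Ord gs) x =
     (if gs = [] then 0
      else let ds = butlast gs; \<gamma> = last gs in
        if \<gamma> = 0 then Ord ds
        else if is_succ \<gamma> then Ord (ds @ replicate x (ord_pred \<gamma>))
        else Ord (ds @ [fund \<gamma> x]))"
  by pat_completeness auto
termination
proof (relation "measure (size \<circ> fst)", simp)
  fix gs :: "ordinal list" and x :: nat and y z
  assume "gs \<noteq> []" "z = last gs"
  then have "z \<in> set gs" by simp
  then have "size z < Suc (size_list size gs)"
    by (meson less_SucI size_list_estimation less_irrefl not_less size_list_estimation' le_imp_less_Suc order_refl)
  then show "((z, x), Ord gs, x) \<in> measure (size \<circ> fst)" by simp
qed

definition fund_set :: "ordinal \<Rightarrow> nat set \<Rightarrow> ordinal" where
  "fund_set \<alpha> X = foldl fund \<alpha> (sorted_list_of_set X)"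

definition large :: "ordinal \<Rightarrow> nat set \<Rightarrow> bool" where
  "large \<alpha> X \<longleftrightarrow> finite X \<and> fund_set \<alpha> X = 0"

definition small :: "ordinal \<Rightarrow> nat set \<Rightarrow> bool" where
  "small \<alpha> X \<longleftrightarrow> finite X \<and> fund_set \<alpha> X \<noteq> 0"

text \<open>
  \<open>Max {}\<close> is unspecified, but \<open>{} - {Max {}} = {}\<close>, so the empty set needs no separate clause.
\<close>

definition exactly_large :: "ordinal \<Rightarrow> nat set \<Rightarrow> bool" where
  "exactly_large \<alpha> X \<longleftrightarrow> large \<alpha> X \<and> small \<alpha> (X - {Max X})"


text \<open>Normal forms are closed under the operations above and well-ordered by \<open><\<close>.\<close>

lemma not_less_0_ordinal [simp]: "\<not> a < (0 :: ordinal)"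
  by (cases a) (simp add: less_ordinal_def zero_ordinal_def)

lemma less_Ord_simps [simp]:
  "\<not> a' < Ord []"
  "Ord [] < Ord (b # bs)"
  "Ord (a # as) < Ord (b # bs) \<longleftrightarrow> a < b \<or> a = b \<and> Ord as < Ord bs"
  by (cases a') (simp_all add: less_ordinal_def)

lemma less_Ord_append: "Ord (ds @ as) < Ord (ds @ bs) \<longleftrightarrow> Ord as < Ord bs"
  by (induction ds) auto

lemma cnf_natural_sum: "cnf \<alpha> \<Longrightarrow> cnf \<beta> \<Longrightarrow> cnf (\<alpha> \<oplus> \<beta>)"
  by (cases \<alpha>; cases \<beta>) (auto simp: natural_sum_def sorted_wrt_rev)

lemma natural_sum_commute: "\<alpha> \<oplus> \<beta> = \<beta> \<oplus> \<alpha>"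
proof -
  have "sort (exps \<alpha> @ exps \<beta>) = sort (exps \<beta> @ exps \<alpha>)"
    by (rule properties_for_sort) (auto simp: union_commute)
  then show ?thesis by (simp add: natural_sum_def)
qed

lemma ord_pred_less: "is_succ \<gamma> \<Longrightarrow> ord_pred \<gamma> < \<gamma>"
proof (cases \<gamma>)
  case (Ord gs)
  assume "is_succ \<gamma>"
  then have "gs \<noteq> []" using Ord by (auto simp: is_succ_def zero_ordinal_def)
  then have "Ord (butlast gs @ []) < Ord (butlast gs @ [last gs])"
    by (simp only: less_Ord_append less_Ord_simps)
  then show ?thesis using Ord \<open>gs \<noteq> []\<close> by (simp add: ord_pred_def)
qed

lemma cnf_ord_pred: "cnf \<gamma> \<Longrightarrow> cnf (ord_pred \<gamma>)"
  by (cases \<gamma>) (auto simp: ord_pred_def butlast_conv_take sorted_wrt_take dest: in_set_takeD)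

lemma fund_less: "\<alpha> \<noteq> 0 \<Longrightarrow> fund \<alpha> x < \<alpha>"
proof (induction \<alpha> x rule: fund.induct)
  case (1 gs x)
  then have ne: "gs \<noteq> []" by (simp add: zero_ordinal_def)
  obtain ds g where gs: "gs = ds @ [g]" using ne by (metis rev_exhaust)
  have rep: "Ord (replicate x (ord_pred g)) < Ord [g]" if "is_succ g"
    using ord_pred_less[OF that] by (cases x) auto
  have "Ord (ds @ []) < Ord (ds @ [g])" by (simp only: less_Ord_append less_Ord_simps)
  then show ?case using 1 rep unfolding gs by (auto simp: Let_def less_Ord_append)
qed

lemma cnf_fund: "cnf \<alpha> \<Longrightarrow> cnf (fund \<alpha> x)"
proof (induction \<alpha> x rule: fund.induct)
  case (1 gs x)
  show ?case
  proof (cases "gs = []")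
    case True
    then show ?thesis by (simp add: zero_ordinal_def)
  next
    case False
    then obtain ds g where gs: "gs = ds @ [g]" by (metis rev_exhaust)
    have d: "sorted_wrt (\<ge>) ds" "\<And>d. d \<in> set ds \<Longrightarrow> cnf d \<and> g \<le> d" and g: "cnf g"
      using "1.prems" unfolding gs by (auto simp: sorted_wrt_append)
    have s: "sorted_wrt (\<ge>) (replicate x (ord_pred g))" by (induction x) auto
    have p: "ord_pred g \<le> d" if "is_succ g" "d \<in> set ds" for d
      using ord_pred_less[of g] d(2)[of d] that by force
    have f: "fund g x \<le> d" if "g \<noteq> 0" "d \<in> set ds" for d
      using fund_less[of g x] d(2)[of d] that by force
    show ?thesis
      using 1 False d g s p f cnf_ord_pred[OF g] unfolding gs
      by (auto simp: Let_def sorted_wrt_append)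
  qed
qed

lemma wf_cnf_less: "wf {(\<alpha>, \<beta>). cnf \<alpha> \<and> cnf \<beta> \<and> \<alpha> < \<beta>}" (is "wf ?R")
proof -
  have step: "Ord (a # as) \<in> Wellfounded.acc ?R"
    if "a \<in> Wellfounded.acc ?R" "cnf (Ord (a # as))" for a as
    using that
  proof (induction a arbitrary: as rule: acc.induct)
    case (accI a)
    have head: "Ord (a # es) \<in> Wellfounded.acc ?R"
      if "t \<in> Wellfounded.acc ?R" "t = Ord es" "cnf (Ord (a # es))" for t es
      using that
    proof (induction t arbitrary: es rule: acc.induct)
      case inner: (accI t)
      show ?case
      proof (rule acc.accI)
        fix y assume y: "(y, Ord (a # es)) \<in> ?R"
        obtain ys where ys: "y = Ord ys" by (cases y)
        show "y \<in> Wellfounded.acc ?R"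
        proof (cases ys)
          case Nil
          show ?thesis unfolding ys Nil by (rule acc.accI) auto
        next
          case (Cons e fs)
          consider "e < a" | "e = a" "Ord fs < Ord es" using y ys Cons by auto
          then show ?thesis
          proof cases
            case 1
            then show ?thesis using accI.IH[of e fs] y ys Cons by auto
          next
            case 2
            then show ?thesis using inner.IH[of "Ord fs" fs] inner.prems y ys Cons by auto
          qed
        qed
      qed
    qed
    show ?case using accI.prems
    proof (induction as)
      case Nil
      have "Ord [] \<in> Wellfounded.acc ?R" by (rule acc.accI) auto
      then show ?case using head Nil by blast
    next
      case (Cons b bs)
      have c: "cnf (Ord (b # bs))" "b \<le> a" "cnf a" "cnf b" "cnf (Ord (a # bs))"
        using Cons.prems by auto
      have "Ord (b # bs) \<in> Wellfounded.acc ?R"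
      proof (cases "b = a")
        case True
        then show ?thesis using Cons.IH c by blast
      next
        case False
        then show ?thesis using accI.IH[of b bs] c by auto
      qed
      then show ?case using head Cons.prems by blast
    qed
  qed
  have cnf_acc: "\<alpha> \<in> Wellfounded.acc ?R" if "cnf \<alpha>" for \<alpha>
    using that
  proof (induction \<alpha>)
    case (Ord gs)
    show ?case
    proof (cases gs)
      case Nil
      show ?thesis unfolding Nil by (rule acc.accI) auto
    next
      case (Cons g hs)
      then show ?thesis using Ord step[of g hs] by auto
    qed
  qed
  have "\<alpha> \<in> Wellfounded.acc ?R" for \<alpha>
    by (rule acc.accI) (use cnf_acc in auto)
  then show ?thesis by (rule acc_wfI[OF allI])
qed

text \<open>
  Sets of natural numbers are meant to consist of positive numbers. If \<open>0\<close> were allowed as an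
  element, the partition property would fail: \<open>\<omega>\<^sup>2\<close> drops to \<open>0\<close> at argument \<open>0\<close>, whereas
  \<open>\<omega>\<^sup>\<omega>\<close> only drops to \<open>1\<close>. Below, \<open>\<alpha> = \<omega>\<^sup>2\<close> and \<open>\<beta> = \<omega>\<^sup>\<omega>\<close>.
\<close>

lemma partition_fails_with_zero:
  defines "\<alpha> \<equiv> Ord [Ord [0, 0]]" and "\<beta> \<equiv> Ord [Ord [Ord [0]]]"
  shows "cnf \<alpha>" "cnf \<beta>" "large (\<alpha> \<oplus> \<beta>) {0, 1, 2, 3, 4}"
    "\<not> large \<alpha> ({1, 2, 3, 4} - {Max {1, 2, 3, 4}})"
    "\<not> large \<beta> ({0} - {Max {0}})" "\<not> large \<beta> {0}"
  unfolding \<alpha>_def \<beta>_def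
  by (simp_all add: large_def fund_set_def natural_sum_def is_succ_def ord_pred_def zero_ordinal_def
      less_eq_ordinal_def Let_def sorted_list_of_set_nonempty insert_Diff_if
      numeral_eq_Suc)

end

theory Submission
  imports Defs
begin

text \<open>
  Removing the least element \<open>x\<close> of \<open>X\<close>, say with \<open>x \<in> X\<^sub>0\<close>, should turn \<open>\<alpha>\<close> into \<open>{\<alpha>}(x)\<close>, so the
  theorem follows by induction once every \<open>{\<alpha> \<oplus> \<beta>}(x)\<close>-large set of numbers above \<open>x\<close> is known to be
  \<open>({\<alpha>}(x) \<oplus> \<beta>)\<close>-large. The two ordinals agree unless the last term of \<open>\<beta>\<close> is smaller than that
  of \<open>\<alpha>\<close>. In that case the second ordinal is smaller than the first but need not be reachable
  from it by steps at the argument \<open>x + 1\<close>; largeness still transfers because a set large for the part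
  of \<open>\<beta>\<close> below the last term of \<open>\<alpha>\<close> has at least as many elements as that part has symbols, so that
  afterwards the elements of the set dominate all relevant coefficients.
\<close>

section \<open>Comparison of normal forms with bounded coefficients\<close>

text \<open>\<open>coeff_less z \<beta> \<alpha>\<close> refines \<open>\<beta> < \<alpha>\<close>: after removal of the common initial segments of the normal
  forms, hereditarily in the exponents, the coefficients of \<open>\<beta>\<close> are less than \<open>z\<close>. Such a relation
  survives the step from \<open>\<alpha>\<close> to \<open>{\<alpha>}(z)\<close>, whereas \<open><\<close> does not.\<close>

inductive coeff_less :: "nat \<Rightarrow> ordinal \<Rightarrow> ordinal \<Rightarrow> bool" for z where
  coeff_lessI: "\<lbrakk>\<forall>a \<in> set as. coeff_less z a b; \<forall>a. count_list as a < z\<rbrakk>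
    \<Longrightarrow> coeff_less z (Ord (ds @ as)) (Ord (ds @ b # bs))"

definition coeff_le :: "nat \<Rightarrow> ordinal \<Rightarrow> ordinal \<Rightarrow> bool" where
  "coeff_le z \<beta> \<alpha> \<longleftrightarrow> \<beta> = \<alpha> \<or> coeff_less z \<beta> \<alpha>"

lemma coeff_less_imp_less: "coeff_less z \<beta> \<alpha> \<Longrightarrow> \<beta> < \<alpha>"
proof (induction rule: coeff_less.induct)
  case (coeff_lessI as b ds bs)
  then have "Ord as < Ord (b # bs)" by (cases as) auto
  then show ?case by (simp only: less_Ord_append)
qed

lemma coeff_less_mono: "coeff_less z \<beta> \<alpha> \<Longrightarrow> z \<le> z' \<Longrightarrow> coeff_less z' \<beta> \<alpha>"
proof (induction rule: coeff_less.induct)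
  case (coeff_lessI as b ds bs)
  then show ?case by (intro coeff_less.coeff_lessI) (auto intro: less_le_trans)
qed

lemma not_coeff_less_zero: "\<not> coeff_less z \<beta> 0"
  using coeff_less_imp_less by fastforce

lemma cnf_append: "cnf (Ord (ds @ es)) \<longleftrightarrow>
    cnf (Ord ds) \<and> cnf (Ord es) \<and> (\<forall>d \<in> set ds. \<forall>e \<in> set es. e \<le> d)"
  by (auto simp: sorted_wrt_append)

text \<open>The delicate case is that the smallest ordinal departs from the middle one inside
  \<open>as\<close>, so that the new tail is \<open>us @ cs\<close>. Exponents in \<open>us\<close>
  are at least \<open>e\<close> by the normal form of \<beta>, those in \<open>cs\<close> are below
  \<open>e\<close>; no exponent occurs in both, so coefficients do not add up.\<close>

lemma coeff_less_trans:
  "coeff_less z \<beta> \<gamma> \<Longrightarrow> coeff_less z \<alpha> \<beta> \<Longrightarrow> cnf \<beta> \<Longrightarrow> coeff_less z \<alpha> \<gamma>"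
proof (induction arbitrary: \<alpha> rule: coeff_less.induct)
  case (coeff_lessI as b ds bs)
  from coeff_lessI.prems(1) obtain es cs e fs where
    \<alpha>: "\<alpha> = Ord (es @ cs)" and eq: "ds @ as = es @ e # fs"
    and cs: "\<forall>c \<in> set cs. coeff_less z c e" "\<forall>c. count_list cs c < z"
    by (auto elim: coeff_less.cases)
  consider us where "ds = es @ e # us" | us where "es = ds @ us" "as = us @ e # fs"
    using eq unfolding append_eq_append_conv2 by (metis append_eq_Cons_conv append_Nil2 self_append_conv)
  then show ?case
  proof cases
    case 1
    then show ?thesis using coeff_less.coeff_lessI[OF cs, of es "us @ b # bs"] \<alpha> by simp
  next
    case 2
    have c: "cnf (Ord (us @ e # fs))" using coeff_lessI.prems(2) 2 cnf_append by metis
    have "coeff_less z a b" if "a \<in> set (us @ cs)" for a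
      using that coeff_lessI.IH cs(1) c 2 by auto
    moreover have "count_list (us @ cs) a < z" for a
    proof (cases "a \<in> set cs")
      case True
      then have "a < e" using cs(1) coeff_less_imp_less by blast
      then have "a \<notin> set us" using c by (auto simp: sorted_wrt_append)
      then show ?thesis using cs(2) by (simp add: count_list_0_iff)
    next
      case False
      have "count_list us a \<le> count_list as a" using 2 by simp
      then show ?thesis
        using False coeff_lessI.hyps
        by (metis (no_types) add.right_neutral count_list_0_iff count_list_append le_less_trans)
    qed
    ultimately show ?thesis
      using coeff_less.coeff_lessI[of "us @ cs" z b ds bs] \<alpha> 2 by simp
  qed
qed

lemma fund_append: "es \<noteq> [] \<Longrightarrow> fund (Ord (ds @ es)) x = Ord (ds @ exps (fund (Ord es) x))"
  by (auto simp: butlast_append Let_def)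

lemma fund_zero [simp]: "fund 0 x = 0"
  by (simp add: zero_ordinal_def)

lemma exps_zero [simp]: "exps 0 = []"
  by (simp add: zero_ordinal_def)

lemma foldl_fund_zero [simp]: "foldl fund 0 xs = 0"
  by (induction xs) auto

lemma fund_single:
  "fund (Ord [c]) x = (if c = 0 then 0 else if is_succ c then Ord (replicate x (ord_pred c))
     else Ord [fund c x])"
  by (simp add: Let_def zero_ordinal_def)

lemma fund_succ: "is_succ c \<Longrightarrow> fund c x = ord_pred c"
  by (cases c) (auto simp: is_succ_def ord_pred_def zero_ordinal_def)

lemma coeff_less_append: "coeff_less z (Ord as) (Ord bs) \<Longrightarrow> coeff_less z (Ord (ds @ as)) (Ord (ds @ bs))"
  by (erule coeff_less.cases) (metis append.assoc coeff_less.coeff_lessI ordinal.inject)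

lemma coeff_less_NilI: "bs \<noteq> [] \<Longrightarrow> z > 0 \<Longrightarrow> coeff_less z (Ord ds) (Ord (ds @ bs))"
  using coeff_lessI[of "[]" z "hd bs" ds "tl bs"] by simp

text \<open>A successor exponent creates the coefficient \<open>x\<close>, hence the threshold
  \<open>Suc x\<close>; a limit exponent creates the coefficient 1, which is below
  \<open>Suc x\<close> as \<open>x\<close> is positive.\<close>

lemma coeff_less_fund: "\<beta> \<noteq> 0 \<Longrightarrow> x > 0 \<Longrightarrow> coeff_less (Suc x) (fund \<beta> x) \<beta>"
proof (induction \<beta> x rule: fund.induct)
  case (1 gs x)
  then have "gs \<noteq> []" by (simp add: zero_ordinal_def)
  then obtain ds c where gs: "gs = ds @ [c]" by (metis rev_exhaust)
  have "coeff_less (Suc x) (fund (Ord [c]) x) (Ord [c])"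
  proof (cases "c = 0 \<or> is_succ c")
    case True
    have "coeff_less (Suc x) (ord_pred c) c" if "c \<noteq> 0"
      using that coeff_less_NilI[of "[last (exps c)]" "Suc x" "butlast (exps c)"]
      by (cases c) (auto simp: ord_pred_def zero_ordinal_def)
    moreover have "count_list (replicate x (ord_pred c)) a \<le> x" for a
      using count_le_length[of "replicate x (ord_pred c)" a] by simp
    ultimately show ?thesis
      using True coeff_lessI[of "replicate x (ord_pred c)" "Suc x" c "[]" "[]"]
        coeff_less_NilI[of "[c]" "Suc x" "[]"]
      by (auto simp: fund_single le_imp_less_Suc zero_ordinal_def[symmetric])
  next
    case False
    then have "coeff_less (Suc x) (fund c x) c" using 1 gs by (simp add: Let_def)
    then show ?thesis
      using False \<open>x > 0\<close> coeff_lessI[of "[fund c x]" "Suc x" c "[]" "[]"] by (simp add: fund_single)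
  qed
  then show ?case unfolding gs
    using coeff_less_append[of "Suc x" "exps (fund (Ord [c]) x)" "[c]" ds]
      fund_append[of "[c]" ds x] by simp
qed

lemma sorted_desc_split_max:
  assumes "sorted_wrt (\<ge>) as" "\<forall>a \<in> set as. a \<le> (b :: 'a :: linorder)"
  shows "\<exists>es. as = replicate (count_list as b) b @ es \<and> b \<notin> set es"
  using assms
proof (induction as)
  case (Cons a as)
  then obtain es where es: "as = replicate (count_list as b) b @ es" "b \<notin> set es" by auto
  show ?case
  proof (cases "a = b")
    case True
    then show ?thesis using es by auto
  next
    case False
    then have "b \<notin> set (a # as)" using Cons.prems by auto
    then show ?thesis using count_list_0_iff[of "a # as" b] by (metis append_Nil replicate_0)
  qed
qed simp

text \<open>In the limit case equality is excluded; otherwise the induction would break down for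
  \<open>\<omega>\<^bsup>\<gamma>\<^esup>\<close> with \<open>\<gamma>\<close> a limit.\<close>

lemma coeff_less_fund_right:
  assumes "coeff_less z \<beta> \<alpha>" "cnf \<beta>"
  shows "coeff_less z \<beta> (fund \<alpha> z) \<or> is_succ \<alpha> \<and> \<beta> = fund \<alpha> z"
  using assms
proof (induction rule: coeff_less.induct)
  case (coeff_lessI as b ds bs)
  have as: "cnf (Ord as)" using coeff_lessI.prems cnf_append by blast
  show ?case
  proof (cases "bs = []")
    case False
    then have "fund (Ord (ds @ b # bs)) z = Ord (ds @ b # exps (fund (Ord bs) z))"
      using fund_append[of bs "ds @ [b]" z] by simp
    then show ?thesis using coeff_lessI by (auto intro: coeff_less.coeff_lessI)
  next
    case True
    have fund: "fund (Ord (ds @ b # bs)) z = Ord (ds @ exps (fund (Ord [b]) z))"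
      using fund_append[of "[b]" ds z] True by simp
    consider "b = 0" | "b \<noteq> 0" "is_succ b" | "b \<noteq> 0" "\<not> is_succ b" by blast
    then show ?thesis
    proof cases
      case 1
      then have "as = []" using coeff_lessI.IH not_coeff_less_zero by (cases as) auto
      then show ?thesis using 1 fund True by (auto simp: fund_single is_succ_def zero_ordinal_def)
    next
      case 2
      let ?k = "count_list as (ord_pred b)"
      have le: "a = ord_pred b \<or> coeff_less z a (ord_pred b)" if "a \<in> set as" for a
        using that coeff_lessI.IH as 2 fund_succ by auto
      have "a \<le> ord_pred b" if "a \<in> set as" for a
        using le[OF that] coeff_less_imp_less[of z a "ord_pred b"] by auto
      then obtain es where es: "as = replicate ?k (ord_pred b) @ es" "ord_pred b \<notin> set es"
        using sorted_desc_split_max as by (metis cnf.simps)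
      have k: "?k < z" using coeff_lessI.hyps by blast
      have sub: "set es \<subseteq> set as" by (subst es(1)) auto
      have cnt: "count_list es a < z" for a
      proof -
        have "count_list as a = count_list (replicate ?k (ord_pred b)) a + count_list es a"
          using es(1) by (metis count_list_append)
        then have "count_list es a \<le> count_list as a" by simp
        then show ?thesis using coeff_lessI.hyps le_less_trans by blast
      qed
      \<comment> \<open>The step yields \<open>z\<close> copies of \<open>ord_pred b\<close> and
        \<open>as\<close> starts with only \<open>?k < z\<close> of them, so the common initial
        segment grows by these and all exponents in \<open>es\<close> are below the next
        one.\<close>
      have "coeff_less z (Ord ((ds @ replicate ?k (ord_pred b)) @ es))
          (Ord ((ds @ replicate ?k (ord_pred b)) @ ord_pred b # replicate (z - ?k - 1) (ord_pred b)))"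
        by (rule coeff_less.coeff_lessI) (use le es(2) sub cnt in auto)
      moreover have "replicate z (ord_pred b) =
          replicate ?k (ord_pred b) @ ord_pred b # replicate (z - ?k - 1) (ord_pred b)"
        using k by (metis Suc_diff_Suc add_diff_inverse_nat diff_Suc_eq_diff_pred diff_commute
          less_imp_le_nat not_le replicate_Suc replicate_add diff_diff_left Suc_eq_plus1)
      ultimately show ?thesis using fund 2 es(1) by (simp add: fund_single)
    next
      case 3
      then have "\<forall>a \<in> set as. coeff_less z a (fund b z)" using coeff_lessI.IH as by auto
      then show ?thesis
        using fund 3 coeff_lessI.hyps coeff_less.coeff_lessI[of as z "fund b z" ds "[]"]
        by (simp add: fund_single)
    qed
  qed
qed

section \<open>Transfer and monotonicity of largeness\<close>

text \<open>The induction hypothesis is used twice: \<beta> is still below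
  \<open>fund \<alpha> x\<close>, so \<open>xs\<close> reduces \<beta> to 0; and
  \<open>fund \<beta> x\<close> is below \<beta> at threshold \<open>Suc x\<close>, so
  \<open>xs\<close> reduces it to 0 as well. The threshold may grow because \<open>xs\<close>
  increases.\<close>

lemma foldl_fund_eq_zero_coeff_le:
  assumes "coeff_le z \<beta> \<alpha>" "foldl fund \<alpha> xs = 0" "cnf \<beta>"
    "sorted_wrt (<) xs" "\<forall>x \<in> set xs. z \<le> x \<and> 0 < x"
  shows "foldl fund \<beta> xs = 0"
  using assms
proof (induction xs arbitrary: z \<alpha> \<beta>)
  case Nil
  then show ?case using not_coeff_less_zero by (auto simp: coeff_le_def)
next
  case (Cons x xs)
  show ?case
  proof (cases "\<beta> = \<alpha> \<or> \<beta> = 0")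
    case True
    then show ?thesis using Cons.prems by auto
  next
    case False
    then have "coeff_less x \<beta> \<alpha>" using Cons.prems by (auto simp: coeff_le_def intro: coeff_less_mono)
    then have "coeff_le x \<beta> (fund \<alpha> x)"
      using coeff_less_fund_right Cons.prems(3) by (auto simp: coeff_le_def)
    then have "foldl fund \<beta> xs = 0" using Cons by fastforce
    moreover have "coeff_le (Suc x) (fund \<beta> x) \<beta>"
      using coeff_less_fund False Cons.prems(5) by (simp add: coeff_le_def)
    ultimately show ?thesis
      using Cons.IH[of "Suc x" "fund \<beta> x" \<beta>] Cons.prems cnf_fund by (auto simp: Suc_le_eq)
  qed
qed

lemma coeff_le_foldl_fund:
  assumes "cnf \<beta>" "\<forall>x \<in> set xs. 0 < x \<and> x < z"
  shows "coeff_le z (foldl fund \<beta> xs) \<beta>"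
  using assms
proof (induction xs arbitrary: \<beta>)
  case Nil
  then show ?case by (simp add: coeff_le_def)
next
  case (Cons x xs)
  show ?case
  proof (cases "\<beta> = 0")
    case True
    then show ?thesis by (simp add: coeff_le_def)
  next
    case False
    then have "coeff_less z (fund \<beta> x) \<beta>"
      using coeff_less_fund[of \<beta> x] coeff_less_mono[of "Suc x" _ _ z] Cons.prems(2) by auto
    then show ?thesis
      using Cons.IH[of "fund \<beta> x"] Cons.prems cnf_fund coeff_less_trans
      by (auto simp: coeff_le_def)
  qed
qed

text \<open>An additional step at \<open>x\<close> only lowers the ordinal, at threshold
  \<open>Suc x\<close>, and all later elements reach that threshold.\<close>

lemma foldl_fund_eq_zero_filter:
  assumes "foldl fund \<beta> (filter P xs) = 0" "cnf \<beta>" "sorted_wrt (<) xs" "\<forall>x \<in> set xs. 0 < x"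
  shows "foldl fund \<beta> xs = 0"
  using assms
proof (induction xs arbitrary: \<beta>)
  case (Cons x xs)
  show ?case
  proof (cases "P x \<or> \<beta> = 0")
    case True
    then show ?thesis using Cons cnf_fund by auto
  next
    case False
    then have "foldl fund \<beta> xs = 0" using Cons by auto
    moreover have "coeff_le (Suc x) (fund \<beta> x) \<beta>"
      using coeff_less_fund False Cons.prems(4) by (simp add: coeff_le_def)
    ultimately show ?thesis
      using foldl_fund_eq_zero_coeff_le[of "Suc x" "fund \<beta> x" \<beta> xs] Cons.prems cnf_fund
      by (auto simp: Suc_le_eq)
  qed
qed auto

section \<open>Counting the symbols of normal forms\<close>

text \<open>This counts the occurrences of \<omega> in the fully expanded normal form, 1 being
  written as the power with exponent 0.\<close>

fun ord_size :: "ordinal \<Rightarrow> nat" where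
  "ord_size (Ord gs) = (\<Sum>g\<leftarrow>gs. Suc (ord_size g))"

lemma ord_size_append: "ord_size (Ord (as @ bs)) = ord_size (Ord as) + ord_size (Ord bs)"
  by simp

lemma ord_size_eq_0_iff [simp]: "ord_size \<alpha> = 0 \<longleftrightarrow> \<alpha> = 0"
  by (cases \<alpha>; cases "exps \<alpha>") (auto simp: zero_ordinal_def)

lemma ord_size_eq_Suc_0: "ord_size \<alpha> = Suc 0 \<Longrightarrow> \<alpha> = Ord [0]"
  by (cases \<alpha>; cases "exps \<alpha>") (auto simp: zero_ordinal_def[symmetric])

text \<open>Passing to a predecessor deletes one symbol, and for positive \<open>x\<close> at least
  one copy of the resulting term remains.\<close>

lemma ord_size_fund: "x > 0 \<Longrightarrow> ord_size \<alpha> \<le> Suc (ord_size (fund \<alpha> x))"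
proof (induction \<alpha> x rule: fund.induct)
  case (1 gs x)
  show ?case
  proof (cases "gs = []")
    case False
    then obtain ds c where gs: "gs = ds @ [c]" by (metis rev_exhaust)
    have "ord_size (Ord [c]) \<le> Suc (ord_size (fund (Ord [c]) x))"
    proof (cases "c = 0 \<or> is_succ c")
      case True
      obtain m where m: "x = Suc m" using 1 by (cases x) auto
      have "ord_size c \<le> Suc (ord_size (ord_pred c))" if s: "is_succ c"
      proof -
        have "c = Ord (exps (ord_pred c) @ [0])"
          using s by (cases c) (auto simp: is_succ_def ord_pred_def zero_ordinal_def,
            metis append_butlast_last_id)
        then have "ord_size c = ord_size (ord_pred c) + ord_size (Ord [0])"
          by (metis ord_size_append ordinal.collapse)
        then show ?thesis by (simp add: zero_ordinal_def)
      qed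
      then show ?thesis using True m by (auto simp: fund_single)
    next
      case False
      then show ?thesis using 1 gs by (simp add: fund_single Let_def)
    qed
    moreover have "ord_size (fund (Ord gs) x) = ord_size (Ord ds) + ord_size (fund (Ord [c]) x)"
      unfolding gs using fund_append[of "[c]" ds x] ord_size_append by (metis ordinal.collapse not_Cons_self2)
    ultimately show ?thesis unfolding gs using ord_size_append[of ds "[c]"] by linarith
  qed simp
qed

lemma fund_eq_zero_imp: "fund \<alpha> x = 0 \<Longrightarrow> x > 0 \<Longrightarrow> \<alpha> = 0 \<or> \<alpha> = Ord [0]"
  using ord_size_fund[of x \<alpha>] ord_size_eq_Suc_0[of \<alpha>]
  by (metis le_Suc_eq le_zero_eq ord_size_eq_0_iff)

lemma ord_size_member: "e \<in> set es \<Longrightarrow> ord_size e < ord_size (Ord es)"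
  using member_le_sum_list[of "Suc (ord_size e)" "map (\<lambda>g. Suc (ord_size g)) es"] by auto

lemma count_list_le_ord_size: "count_list es e * Suc (ord_size e) \<le> ord_size (Ord es)"
  by (induction es) auto

lemma less_Ord_split:
  "Ord as < Ord bs \<Longrightarrow> \<exists>ds es c cs. as = ds @ es \<and> bs = ds @ c # cs \<and> (es = [] \<or> hd es < c)"
proof (induction as arbitrary: bs)
  case Nil
  then show ?case by (cases bs) auto
next
  case (Cons a as)
  then obtain b bs' where bs: "bs = b # bs'" by (cases bs) auto
  show ?case
  proof (cases "a < b")
    case True
    then have "a # as = [] @ a # as \<and> bs = [] @ b # bs' \<and> (a # as = [] \<or> hd (a # as) < b)"
      using bs by simp
    then show ?thesis by blast
  next
    case False
    then have "a = b" "Ord as < Ord bs'" using Cons.prems bs by auto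
    then show ?thesis using Cons.IH[of bs'] bs by (metis append_Cons)
  qed
qed

text \<open>The number of symbols bounds every coefficient, and exponents have fewer symbols than
  the whole term.\<close>

lemma coeff_less_if_ord_size_less:
  "\<beta> < \<alpha> \<Longrightarrow> cnf \<beta> \<Longrightarrow> ord_size \<beta> < z \<Longrightarrow> coeff_less z \<beta> \<alpha>"
proof (induction \<beta> arbitrary: \<alpha>)
  case (Ord as)
  obtain bs where \<alpha>: "\<alpha> = Ord bs" by (cases \<alpha>)
  obtain ds es c cs where split: "as = ds @ es" "bs = ds @ c # cs" "es = [] \<or> hd es < c"
    using Ord.prems(1) less_Ord_split unfolding \<alpha> by blast
  have "coeff_less z e c" if "e \<in> set es" for e
  proof (rule Ord.IH)
    have "sorted_wrt (\<ge>) es" using Ord.prems(2) split by (simp add: sorted_wrt_append)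
    then have "e \<le> hd es" using that by (cases es) auto
    then show "e < c" using split that by auto
    show "e \<in> set as" using that split by simp
    then show "cnf e" "ord_size e < z"
      using Ord.prems ord_size_member[of e as] by auto
  qed
  moreover have "count_list es e < z" for e
  proof -
    have "count_list es e \<le> count_list es e * Suc (ord_size e)" by simp
    also have "\<dots> \<le> ord_size (Ord es)" by (rule count_list_le_ord_size)
    also have "\<dots> \<le> ord_size (Ord as)" using split by simp
    finally show ?thesis using Ord.prems(3) by simp
  qed
  ultimately show ?case unfolding \<alpha> split by (intro coeff_lessI) auto
qed

text \<open>Steps act on the last term, so \<open>es\<close> is exhausted before \<open>ds\<close>
  is touched, and each step removes at most one symbol.\<close>

lemma foldl_fund_append_split:
  assumes "foldl fund (Ord (ds @ es)) xs = 0" "\<forall>x \<in> set xs. 0 < x" "ds \<noteq> []"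
  shows "\<exists>ys zs. xs = ys @ zs \<and> foldl fund (Ord ds) zs = 0 \<and> ord_size (Ord es) \<le> length ys"
  using assms
proof (induction xs arbitrary: es)
  case Nil
  then show ?case by (simp add: zero_ordinal_def)
next
  case (Cons x xs)
  show ?case
  proof (cases "es = []")
    case True
    then show ?thesis using Cons.prems(1) by (intro exI[of _ "[]"] exI[of _ "x # xs"]) simp
  next
    case False
    then have "foldl fund (Ord (ds @ exps (fund (Ord es) x))) xs = 0"
      using Cons.prems(1) fund_append by simp
    then obtain ys zs where "xs = ys @ zs" "foldl fund (Ord ds) zs = 0"
      "ord_size (fund (Ord es) x) \<le> length ys"
      using Cons by (metis list.set_intros(2) ordinal.collapse)
    then show ?thesis
      using ord_size_fund[of x "Ord es"] Cons.prems(2) by (intro exI[of _ "x # ys"] exI[of _ zs]) auto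
  qed
qed

section \<open>The exchange step for natural sums\<close>

text \<open>The first \<open>m\<close> elements remove one unit on both sides. The next element
  \<open>z\<close> then turns \<omega> into \<open>z\<close> and \<open>Suc x\<close> into
  \<open>x\<close>, and \<open>x < z\<close>.\<close>

lemma foldl_fund_omega_exchange:
  assumes "foldl fund (Ord (ds @ Ord [0] # replicate m 0)) xs = 0"
    "cnf (Ord (ds @ replicate (Suc (x + m)) 0))" "sorted_wrt (<) xs" "\<forall>y \<in> set xs. x < y"
  shows "foldl fund (Ord (ds @ replicate (Suc (x + m)) 0)) xs = 0"
  using assms
proof (induction m arbitrary: xs)
  case 0
  then obtain z zs where xs: "xs = z # zs" by (cases xs) (auto simp: zero_ordinal_def)
  have fund: "fund (Ord (ds @ [Ord [0]])) z = Ord (ds @ replicate z 0)"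
    by (simp add: is_succ_def ord_pred_def zero_ordinal_def)
  have step: "fund (Ord (ds @ replicate (Suc x) 0)) z = Ord (ds @ replicate x 0)"
    using fund_append[of "[0]" "ds @ replicate x 0" z]
    by (simp add: replicate_append_same fund_single)
  have "coeff_less z (Ord (ds @ replicate x 0)) (Ord ((ds @ replicate x 0) @ replicate (z - x) 0))"
    by (rule coeff_less_NilI) (use 0 xs in auto)
  moreover have "replicate x (0::ordinal) @ replicate (z - x) 0 = replicate z 0"
    using 0 xs by (metis replicate_add add_diff_inverse_nat less_imp_le not_less list.set_intros(1))
  ultimately have "coeff_le z (Ord (ds @ replicate x 0)) (Ord (ds @ replicate z 0))"
    by (simp add: coeff_le_def)
  moreover have "cnf (Ord (ds @ replicate x 0))" using cnf_fund[OF "0.prems"(2), of z] step by simp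
  moreover have "foldl fund (Ord (ds @ replicate z 0)) zs = 0"
    using "0.prems"(1) xs fund by (simp del: fund.simps)
  ultimately have "foldl fund (Ord (ds @ replicate x 0)) zs = 0"
    using foldl_fund_eq_zero_coeff_le[of z _ _ zs] 0 xs by (fastforce simp del: cnf.simps fund.simps)
  then show ?case using xs step by (simp del: fund.simps replicate_Suc)
next
  case (Suc m)
  then obtain y ys where xs: "xs = y # ys" by (cases xs) (auto simp: zero_ordinal_def)
  have *: "fund (Ord (es @ replicate (Suc k) 0)) y = Ord (es @ replicate k 0)" for es k
    using fund_append[of "[0]" "es @ replicate k 0" y]
    by (simp add: replicate_append_same fund_single)
  show ?case
    using Suc.IH[of ys] Suc.prems xs *[of "ds @ [Ord [0]]" m] *[of ds "Suc (x + m)"]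
      cnf_fund[OF Suc.prems(2), of y]
    by (simp del: fund.simps cnf.simps replicate_Suc)
qed


lemma rev_sort_eqI: "sorted_wrt (\<ge>) ys \<Longrightarrow> mset ys = mset xs \<Longrightarrow> rev (sort xs) = ys"
  by (metis mset_rev properties_for_sort rev_swap sorted_wrt_rev)

lemma sorted_desc_split_threshold:
  "sorted_wrt (\<ge>) bs \<Longrightarrow> bs = filter (\<lambda>b. c \<le> b) bs @ filter (\<lambda>b. b < c) bs" for c :: "'a :: linorder"
proof (induction bs)
  case (Cons b bs)
  show ?case
  proof (cases "c \<le> b")
    case False
    then have "filter (\<lambda>b. c \<le> b) bs = []" using Cons.prems by (fastforce simp: filter_empty_conv)
    then show ?thesis using False Cons by auto
  qed (use Cons in auto)
qed simp

lemma sorted_wrt_less_gap: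
  assumes "sorted_wrt (<) (ys @ [z])" "\<forall>y \<in> set (ys @ [z]). x < (y::nat)"
  shows "x + length ys < z"
  using assms
proof (induction ys arbitrary: x)
  case (Cons y ys)
  then have "y + length ys < z" by auto
  then show ?case using Cons.prems by auto
qed simp

text \<open>If \<open>\<omega>\<^sup>\<gamma>\<close> is the last term of \<open>\<alpha>\<close> and \<open>\<epsilon>\<close> is the part of \<open>\<beta>\<close> below \<open>\<omega>\<^sup>\<gamma>\<close>, both sides share all
  terms except that the premise has \<open>\<omega>\<^sup>\<gamma> + {\<epsilon>}(x)\<close> where the conclusion has \<open>{\<omega>\<^sup>\<gamma>}(x) \<oplus> \<epsilon>\<close>. When
  \<open>{\<epsilon>}(x)\<close> has been consumed, the next element of \<open>xs\<close> exceeds \<open>x\<close> by at least the size of \<open>\<epsilon>\<close>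
  and hence bounds the coefficients of \<open>{\<omega>\<^sup>\<gamma>}(x) \<oplus> \<epsilon>\<close>. This estimate is off by one for \<open>\<gamma> = 1\<close>,
  which is treated separately.\<close>

lemma natural_sum_fund_exchange:
  assumes "cnf \<alpha>" "cnf \<beta>" "\<alpha> \<noteq> 0" "x > 0" "sorted_wrt (<) xs" "\<forall>y \<in> set xs. x < y"
    and large: "foldl fund (fund (\<alpha> \<oplus> \<beta>) x) xs = 0"
  shows "foldl fund (fund \<alpha> x \<oplus> \<beta>) xs = 0"
proof -
  obtain as bs where \<alpha>': "\<alpha> = Ord as" and \<beta>: "\<beta> = Ord bs" by (metis ordinal.exhaust)
  obtain as' c where as: "as = as' @ [c]" using \<alpha>' assms(3) by (metis rev_exhaust zero_ordinal_def)
  have \<alpha>: "\<alpha> = Ord (as' @ [c])" using \<alpha>' as by simp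
  \<comment> \<open>\<open>es\<close> is the part \<epsilon> of \<beta>; \<open>ds\<close> below
    collects the remaining terms of both summands apart from the last term of \<alpha>.\<close>
  define bs' where "bs' = filter (\<lambda>b. c \<le> b) bs"
  define es where "es = filter (\<lambda>b. b < c) bs"
  have bs: "bs = bs' @ es"
    using sorted_desc_split_threshold assms(2) unfolding \<beta> bs'_def es_def by auto
  define ds where "ds = rev (sort (as' @ bs'))"
  define ts where "ts = exps (fund (Ord [c]) x)"
  have ts: "fund (Ord [c]) x = Ord ts" by (simp add: ts_def)
  have ds: "sorted_wrt (\<ge>) ds" "mset ds = mset as' + mset bs'" "\<forall>d \<in> set ds. c \<le> d"
    using assms(1) unfolding ds_def bs'_def \<alpha> by (auto simp: sorted_wrt_rev sorted_wrt_append)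
  have es: "sorted_wrt (\<ge>) es" "\<forall>e \<in> set es. e < c" "\<forall>e \<in> set es. cnf e"
    using assms(2) unfolding \<beta> es_def by (auto intro: sorted_wrt_filter)
  have cts: "coeff_less (Suc x) (Ord ts) (Ord [c])"
    using coeff_less_fund[of "Ord [c]" x] assms(4) ts by (simp add: zero_ordinal_def)
  have ts_less: "\<forall>t \<in> set ts. coeff_less (Suc x) t c" and ts_count: "\<forall>t. count_list ts t \<le> x"
    using cts by (auto elim!: coeff_less.cases simp: Cons_eq_append_conv less_Suc_eq_le)
  have sum: "\<alpha> \<oplus> \<beta> = Ord (ds @ c # es)"
    unfolding natural_sum_def \<alpha> \<beta> bs ordinal.sel ordinal.inject
    by (rule rev_sort_eqI) (use ds es in \<open>force simp: sorted_wrt_append\<close>)+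
  have fund_\<alpha>: "fund \<alpha> x = Ord (as' @ ts)"
    using fund_append[of "[c]" as' x] \<alpha> by (simp add: ts_def)
  define rs where "rs = rev (sort (ts @ es))"
  have rs: "sorted_wrt (\<ge>) rs" "mset rs = mset ts + mset es"
    unfolding rs_def by (auto simp: sorted_wrt_rev)
  have set_rs: "set rs = set ts \<union> set es" unfolding rs_def by auto
  have rs_less: "\<forall>r \<in> set rs. r < c"
    using set_rs es ts_less coeff_less_imp_less by blast
  have goal: "fund \<alpha> x \<oplus> \<beta> = Ord (ds @ rs)"
    unfolding fund_\<alpha> natural_sum_def \<beta> bs ordinal.sel ordinal.inject
    by (rule rev_sort_eqI) (use ds rs rs_less in \<open>force simp: sorted_wrt_append\<close>)+
  have cnf_goal: "cnf (Ord (ds @ rs))"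
    using cnf_natural_sum cnf_fund assms(1,2) goal by metis
  show ?thesis
  proof (cases "es = []")
    case True
    then have "rs = ts" using cnf_fund[OF assms(1), of x] fund_\<alpha>
      unfolding rs_def by (intro rev_sort_eqI) (auto simp: sorted_wrt_append)
    then have "fund (\<alpha> \<oplus> \<beta>) x = fund \<alpha> x \<oplus> \<beta>"
      using sum True goal fund_append[of "[c]" ds x] ts by simp
    then show ?thesis using large by simp
  next
    case False
    define fs where "fs = exps (fund (Ord es) x)"
    have large': "foldl fund (Ord (ds @ c # fs)) xs = 0"
      using large sum fund_append[OF False, of "ds @ [c]" x] by (simp add: fs_def)
    have c0: "c \<noteq> 0" using False es by (cases es) auto
    show ?thesis
    proof (cases "c = Ord [0]")
      case True
      have "\<forall>e \<in> set es. e = 0"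
      proof
        fix e assume "e \<in> set es"
        then have "e < Ord [0]" using es True by auto
        then show "e = 0" by (cases e; cases "exps e") (auto simp: zero_ordinal_def)
      qed
      then obtain m where m: "es = replicate (Suc m) 0"
        using False by (metis Suc_pred length_greater_0_conv replicate_length_same)
      have "ts = replicate x 0"
        using ts True by (simp add: is_succ_def ord_pred_def zero_ordinal_def)
      then have "rs = replicate (Suc (x + m)) 0" unfolding rs_def m
        by (intro rev_sort_eqI) (auto simp: sorted_wrt_iff_nth_less nth_Cons' simp flip: replicate_add replicate_Suc)
      moreover have "fs = replicate m 0"
        unfolding fs_def m using fund_append[of "[0]" "replicate m 0" x]
        by (simp add: replicate_append_same fund_single)
      ultimately show ?thesis
        using foldl_fund_omega_exchange[of ds m xs x] large' True cnf_goal goal assms(5,6) by simp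
    next
      case False
      obtain ys zs where split: "xs = ys @ zs" "foldl fund (Ord (ds @ [c])) zs = 0"
        "ord_size (Ord fs) \<le> length ys"
        using foldl_fund_append_split[of "ds @ [c]" fs xs] large' assms(6) by fastforce
      then obtain z zs' where z: "zs = z # zs'" by (cases zs) (auto simp: zero_ordinal_def)
      have xz: "x + length ys < z"
        by (rule sorted_wrt_less_gap) (use assms split z in \<open>auto simp: sorted_wrt_append\<close>)
      have "ord_size (Ord es) \<le> Suc (ord_size (Ord fs))"
        using ord_size_fund[of x "Ord es"] assms(4) by (simp add: fs_def del: ord_size.simps)
      \<comment> \<open>The step at \<open>x\<close> costs \<epsilon> at most one symbol, which is
        made up for by the strict inequality \<open>x + length ys < z\<close>.\<close>
      then have size: "x + ord_size (Ord es) \<le> z" using split xz by linarith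
      have "coeff_less z r c" if "r \<in> set rs" for r
      proof (cases "r \<in> set ts")
        case True
        then show ?thesis using ts_less xz by (auto intro: coeff_less_mono)
      next
        case False
        then have "r \<in> set es" using that set_rs by blast
        then show ?thesis
          using es ord_size_member[of r es] size by (intro coeff_less_if_ord_size_less) auto
      qed
      moreover have "count_list rs r < z" for r
      proof -
        have cnt: "count_list rs r = count_list ts r + count_list es r"
          using rs(2) by (metis count_mset count_union)
        show ?thesis
        \<comment> \<open>The bounds \<open>x\<close> for \<open>ts\<close> and
          \<open>ord_size (Ord es)\<close> for \<open>es\<close> may add up to exactly
          \<open>z\<close>, so one must be improved. A nonzero \<open>r\<close> costs at least two
          symbols per occurrence in \<open>es\<close>; and 0 does not occur in \<open>ts\<close>,
          since \<gamma> is not 1.\<close>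
        proof (cases "r = 0")
          case True
          have "0 \<notin> set ts"
          proof
            assume "0 \<in> set ts"
            then have "fund c x = 0"
              using ts c0 fund_succ[of c x] by (auto simp: fund_single simp del: fund.simps split: if_splits)
            then show False using fund_eq_zero_imp assms(4) c0 \<open>c \<noteq> Ord [0]\<close> by blast
          qed
          then have "count_list rs r \<le> ord_size (Ord es)"
            using cnt True count_list_le_ord_size[of es r]
            by (simp add: count_list_0_iff del: ord_size.simps)
          then show ?thesis using size assms(4) by linarith
        next
          case False
          have "ord_size (Ord es) \<noteq> 0" using \<open>es \<noteq> []\<close> by (cases es) auto
          moreover have "ord_size r \<noteq> 0" using False by simp
          then have "2 * count_list es r \<le> ord_size (Ord es)"
            using count_list_le_ord_size[of es r] by (cases "ord_size r") auto
          ultimately have "count_list es r < ord_size (Ord es)" by linarith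
          then show ?thesis using cnt ts_count size by (metis add_le_less_mono order_less_le_trans)
        qed
      qed
      \<comment> \<open>The elements of \<open>ys\<close> lie below \<open>z\<close>, so reducing
        \<open>ds @ rs\<close> along \<open>ys\<close> keeps it below \<open>ds @ [c]\<close> at
        threshold \<open>z\<close>, and \<open>zs\<close> then finishes both.\<close>
      ultimately have "coeff_less z (Ord (ds @ rs)) (Ord (ds @ [c]))" by (intro coeff_lessI) auto
      moreover have "coeff_le z (foldl fund (Ord (ds @ rs)) ys) (Ord (ds @ rs))"
        by (rule coeff_le_foldl_fund) (use cnf_goal assms split z in \<open>auto simp: sorted_wrt_append\<close>)
      ultimately have "coeff_le z (foldl fund (Ord (ds @ rs)) ys) (Ord (ds @ [c]))"
        using coeff_less_trans cnf_goal by (auto simp: coeff_le_def)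
      moreover have "cnf (foldl fund \<gamma> ys)" if "cnf \<gamma>" for \<gamma>
        using that by (induction ys arbitrary: \<gamma>) (auto intro: cnf_fund)
      ultimately have "foldl fund (foldl fund (Ord (ds @ rs)) ys) zs = 0"
        by (intro foldl_fund_eq_zero_coeff_le[OF _ split(2)])
          (use cnf_goal assms(4,5,6) split(1) z in \<open>auto simp: sorted_wrt_append\<close>)
      then show ?thesis using goal split(1) by simp
    qed
  qed
qed

lemma natural_sum_zero_left: "cnf \<beta> \<Longrightarrow> 0 \<oplus> \<beta> = \<beta>"
  by (cases \<beta>) (auto simp: natural_sum_def intro: rev_sort_eqI)

lemma natural_sum_eq_zero: "\<alpha> \<oplus> \<beta> = 0 \<Longrightarrow> \<alpha> = 0"
  by (cases \<alpha>) (metis Nil_is_append_conv Nil_is_rev_conv natural_sum_def ordinal.sel set_empty set_sort zero_ordinal_def)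

section \<open>The partition property for lists and for sets\<close>

text \<open>Splitting by a predicate lets the case that the least element belongs to \<beta> be
  reduced to the other one by negating \<open>P\<close> and commuting the sum.\<close>

lemma partition_foldl_fund:
  assumes "cnf \<alpha>" "cnf \<beta>" "sorted_wrt (<) xs" "\<forall>x \<in> set xs. 0 < x" "foldl fund (\<alpha> \<oplus> \<beta>) xs = 0"
  shows "foldl fund \<alpha> (butlast (filter P xs)) = 0 \<or>
    foldl fund \<beta> (butlast (filter (\<lambda>x. \<not> P x) xs)) = 0 \<or>
    foldl fund \<alpha> (filter P xs) = 0 \<and> foldl fund \<beta> (filter (\<lambda>x. \<not> P x) xs) = 0"
  using assms
proof (induction xs arbitrary: \<alpha> \<beta> P)
  case Nil
  then show ?case using natural_sum_eq_zero by auto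
next
  case (Cons x xs)
  have first: "foldl fund \<alpha> (butlast (filter P (x # xs))) = 0 \<or>
      foldl fund \<beta> (butlast (filter (\<lambda>x. \<not> P x) (x # xs))) = 0 \<or>
      foldl fund \<alpha> (filter P (x # xs)) = 0 \<and> foldl fund \<beta> (filter (\<lambda>x. \<not> P x) (x # xs)) = 0"
    if \<alpha>\<beta>: "cnf \<alpha>" "cnf \<beta>" "foldl fund (\<alpha> \<oplus> \<beta>) (x # xs) = 0" "P x" for \<alpha> \<beta> P
  proof (cases "\<alpha> = 0")
    case False
    then have large: "foldl fund (fund \<alpha> x \<oplus> \<beta>) xs = 0"
      using natural_sum_fund_exchange[of \<alpha> \<beta> x xs] \<alpha>\<beta> Cons.prems(3,4) by simp
    show ?thesis
    \<comment> \<open>If \<open>x\<close> is the only element satisfying \<open>P\<close>, then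
      \<open>butlast\<close> drops \<open>x\<close> itself. When \<open>fund \<alpha> x = 0\<close>,
      the first alternative is therefore lost, but \<open>large\<close> says that \<open>xs\<close>
      reduces \<beta> to 0, which gives the third.\<close>
    proof (cases "filter P xs = []")
      case True
      then have "filter (\<lambda>x. \<not> P x) xs = xs" by (auto simp: filter_empty_conv filter_id_conv)
      then show ?thesis
        using Cons.IH[OF cnf_fund[OF \<alpha>\<beta>(1)] \<alpha>\<beta>(2) _ _ large, of P] Cons.prems(3,4) \<alpha>\<beta>(2,4) large
        True natural_sum_zero_left by auto
    next
      case False
      then show ?thesis
        using Cons.IH[OF cnf_fund[OF \<alpha>\<beta>(1)] \<alpha>\<beta>(2) _ _ large, of P] Cons.prems(3,4) \<alpha>\<beta>(4) by auto
    qed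
  qed simp
  show ?case
  proof (cases "P x")
    case True
    then show ?thesis using first Cons.prems by blast
  next
    case False
    have "foldl fund (\<beta> \<oplus> \<alpha>) (x # xs) = 0" using Cons.prems(5) natural_sum_commute by metis
    then show ?thesis
      using first[of \<beta> \<alpha> "\<lambda>x. \<not> P x"] False Cons.prems(1,2) by (auto simp del: fund.simps)
  qed
qed

lemma sorted_list_of_set_remove_Max:
  assumes "finite X"
  shows "sorted_list_of_set (X - {Max X}) = butlast (sorted_list_of_set X)"
proof (cases "X = {}")
  case False
  define xs where "xs = sorted_list_of_set X"
  have X: "X = set xs" "sorted xs" "distinct xs" "xs \<noteq> []" using assms False by (auto simp: xs_def)
  then obtain ys m where xs: "xs = ys @ [m]" by (metis rev_exhaust)
  have "Max X = m" using X xs by (intro Max_eqI) (auto simp: sorted_append)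
  then have "X - {Max X} = set ys" using X xs by auto
  moreover have "sorted_list_of_set (set ys) = ys"
    using X xs by (intro sorted_list_of_set.idem_if_sorted_distinct) (auto simp: sorted_append)
  ultimately show ?thesis using xs xs_def by (metis butlast_snoc)
qed simp

lemma sorted_list_of_set_subset:
  assumes "finite X" "Y \<subseteq> X"
  shows "sorted_list_of_set Y = filter (\<lambda>x. x \<in> Y) (sorted_list_of_set X)"
proof -
  have "set (filter (\<lambda>x. x \<in> Y) (sorted_list_of_set X)) = Y" using assms by auto
  then show ?thesis
    using sorted_list_of_set.idem_if_sorted_distinct[of "filter (\<lambda>x. x \<in> Y) (sorted_list_of_set X)"]
    by (simp add: sorted_wrt_filter)
qed

lemma large_superset:
  assumes "large \<alpha> Y" "Y \<subseteq> X" "finite X" "X \<subseteq> {1..}" "cnf \<alpha>"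
  shows "large \<alpha> X"
  using assms foldl_fund_eq_zero_filter[of \<alpha> "\<lambda>x. x \<in> Y" "sorted_list_of_set X"]
    sorted_list_of_set_subset[of X Y]
  by (auto simp: large_def fund_set_def Suc_le_eq subset_eq)

theorem mainTheorem5:
  fixes \<alpha> \<beta> :: ordinal and X X0 X1 :: "nat set"
  assumes "cnf \<alpha>" and "cnf \<beta>"
    and "X = X0 \<union> X1" and "X \<subseteq> {1..}" and "finite X" and "large (\<alpha> \<oplus> \<beta>) X"
  shows "large \<alpha> (X0 - {Max X0}) \<or> large \<beta> (X1 - {Max X1}) \<or>
         exactly_large \<alpha> X0 \<and> exactly_large \<beta> X1"
proof -
  \<comment> \<open>The list version needs disjoint classes, so common elements go to
    \<open>X0\<close>; monotonicity of largeness leads back from \<open>?Y\<close> to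
    \<open>X1\<close>.\<close>
  let ?Y = "X1 - X0"
  have fin: "finite X0" "finite X1" "finite ?Y" using assms(3,5) by auto
  have pos: "X1 \<subseteq> {1..}" using assms(3,4) by auto
  have "filter (\<lambda>x. x \<in> ?Y) (sorted_list_of_set X) = filter (\<lambda>x. x \<notin> X0) (sorted_list_of_set X)"
    using assms(3,5) by (intro filter_cong) auto
  then have lists: "sorted_list_of_set X0 = filter (\<lambda>x. x \<in> X0) (sorted_list_of_set X)"
    "sorted_list_of_set ?Y = filter (\<lambda>x. x \<notin> X0) (sorted_list_of_set X)"
    using sorted_list_of_set_subset[OF assms(5), of X0] sorted_list_of_set_subset[OF assms(5), of ?Y]
      assms(3) by auto
  have "large \<alpha> (X0 - {Max X0}) \<or> large \<beta> (?Y - {Max ?Y}) \<or> large \<alpha> X0 \<and> large \<beta> ?Y"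
    using partition_foldl_fund[of \<alpha> \<beta> "sorted_list_of_set X" "\<lambda>x. x \<in> X0"] assms(1,2,4-6) fin
      sorted_list_of_set_remove_Max[of X0] sorted_list_of_set_remove_Max[of ?Y] lists
    by (auto simp: large_def fund_set_def subset_eq Suc_le_eq)
  moreover have "large \<beta> (X1 - {Max X1})" if "large \<beta> (?Y - {Max ?Y})"
  proof (rule large_superset[OF that])
    show "?Y - {Max ?Y} \<subseteq> X1 - {Max X1}"
    proof
      fix y assume y: "y \<in> ?Y - {Max ?Y}"
      then have "y < Max ?Y" using fin by (metis Diff_iff Max_ge insertI1 order_le_imp_less_or_eq)
      also have "Max ?Y \<le> Max X1" using y fin by (intro Max_mono) auto
      finally show "y \<in> X1 - {Max X1}" using y by auto
    qed
  qed (use fin pos assms(2) in auto)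
  moreover have "large \<beta> X1" if "large \<beta> ?Y"
    using large_superset[OF that] fin pos assms(2) by blast
  \<comment> \<open>If the first two alternatives fail, both sets are small without their maxima,
    which makes largeness exact.\<close>
  moreover have "small \<gamma> Y \<or> large \<gamma> Y" if "finite Y" for \<gamma> Y
    using that by (auto simp: small_def large_def)
  ultimately show ?thesis using fin by (metis exactly_large_def finite_Diff)
qed

end
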